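(* Let $\mathbb{P}$ be a projective space with line set $\mathcal{L}$, and let $\parallel_1$ and $\parallel_2$ be parallelisms on $\mathbb{P}$. Then the following hold. (a) Any blend of $\parallel_1$ and $\parallel_2$ is a parallelism on $\mathbb{P}$. (b) A parallelism $\parallel_3$ on $\mathbb{P}$ is a blend of $\parallel_1$ and $\parallel_2$ if, and only if, for all $M,N\in\mathcal{L}$: $M\parallel_3 N$ implies ($M\parallel_1 N$ or $M\parallel_2 N$).
   Context: Let $\mathbb{P}$ be a projective space (of arbitrary dimension) with point set $\mathcal{P}$ and line set $\mathcal{L}$. A parallelism on $\mathbb{P}$ is an equivalence relation on $\mathcal{L}$ such that each point $q\in\mathcal{P}$ is incident with precisely one line from each equivalence class. Given equivalence relations $\pi_1,\pi_2$ on $\mathcal{L}$, an equivalence relation $\pi_3$ on $\mathcal{L}$ is called a blend of $\pi_1$ and $\pi_2$ if every $\pi_3$-class is a $\pi_1$-class or a $\pi_2$-class. *)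

theory Defs
  imports Main
begin

text \<open>
  Synthetic projective spaces given by the axioms of Veblen and Young. Points and lines are
  abstract objects and incidence is a relation between them. No non-degeneracy or dimension
  axiom is imposed, so that the empty space, a single point, a single line and planes
  are all admitted, as are infinite-dimensional spaces.
\<close>

locale projective_space =
  fixes P :: "'p set" and L :: "'l set" and incident :: "'p \<Rightarrow> 'l \<Rightarrow> bool"
  assumes unique_join:
      "\<lbrakk>a \<in> P; b \<in> P; a \<noteq> b\<rbrakk> \<Longrightarrow> \<exists>!M. M \<in> L \<and> incident a M \<and> incident b M"
    and veblen_young:
      "\<lbrakk>a \<in> P; b \<in> P; c \<in> P; d \<in> P; distinct [a, b, c, d];
        M \<in> L; incident a M; incident b M;
        N \<in> L; incident c N; incident d N;
        \<exists>x\<in>P. incident x M \<and> incident x N;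
        M' \<in> L; incident a M'; incident c M';
        N' \<in> L; incident b N'; incident d N'\<rbrakk>
       \<Longrightarrow> \<exists>y\<in>P. incident y M' \<and> incident y N'"
    and three_points:
      "M \<in> L \<Longrightarrow> \<exists>a\<in>P. \<exists>b\<in>P. \<exists>c\<in>P. distinct [a, b, c] \<and>
         incident a M \<and> incident b M \<and> incident c M"

definition parallelism ::
  "'p set \<Rightarrow> 'l set \<Rightarrow> ('p \<Rightarrow> 'l \<Rightarrow> bool) \<Rightarrow> ('l \<times> 'l) set \<Rightarrow> bool" where
  "parallelism P L incident r \<longleftrightarrow>
     equiv L r \<and> (\<forall>q\<in>P. \<forall>C\<in>L // r. \<exists>!M. M \<in> C \<and> incident q M)"

text \<open>
  The notion of a blend is meant for equivalence relations \<open>r1\<close> and \<open>r2\<close> on \<open>L\<close>;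
  the relation \<open>r3\<close> is the blend of \<open>r1\<close> and \<open>r2\<close>.
\<close>

definition blend ::
  "'l set \<Rightarrow> ('l \<times> 'l) set \<Rightarrow> ('l \<times> 'l) set \<Rightarrow> ('l \<times> 'l) set \<Rightarrow> bool" where
  "blend L r1 r2 r3 \<longleftrightarrow>
     equiv L r3 \<and> (\<forall>C\<in>L // r3. C \<in> L // r1 \<or> C \<in> L // r2)"

end

theory Submission
  imports Defs
begin

text \<open>
  Each class of a parallelism is a spread: its lines partition the points. A class of a blend is a
  class of one of the given parallelisms, hence a spread, which gives the first part.

  For the second part, the implication from the blend property is immediate. Conversely, let \<open>C\<close>
  be a class of a parallelism \<open>par3\<close> contained in the union of \<open>par1\<close> and \<open>par2\<close>. Any two
  lines of \<open>C\<close> are related by \<open>par1\<close> or by \<open>par2\<close>. Just as a group is not the union of two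
  proper subgroups, one of the two relations must already relate all pairs from \<open>C\<close>
  (\<open>equiv_union_complete\<close>), so \<open>C\<close> lies inside a single class \<open>D\<close> of that relation. But two
  nested spreads coincide (\<open>spread_subset_eq\<close>), because every line has a point; so \<open>C = D\<close>.
\<close>

text \<open>
  If \<open>s\<close> fails to relate \<open>c\<close> and \<open>d\<close>, then \<open>r\<close> relates them, and no \<open>x\<close> can be \<open>s\<close>-related
  to both. Hence every \<open>x\<close> is \<open>r\<close>-related to one of them, and so to \<open>c\<close>.
\<close>
lemma equiv_union_complete:
  assumes r: "equiv A r" and s: "equiv A s"
    and cover: "\<And>x y. x \<in> C \<Longrightarrow> y \<in> C \<Longrightarrow> (x, y) \<in> r \<or> (x, y) \<in> s"
  shows "(\<forall>x\<in>C. \<forall>y\<in>C. (x, y) \<in> r) \<or> (\<forall>x\<in>C. \<forall>y\<in>C. (x, y) \<in> s)"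
proof (rule disjCI)
  assume "\<not> (\<forall>x\<in>C. \<forall>y\<in>C. (x, y) \<in> s)"
  then obtain c d where cd: "c \<in> C" "d \<in> C" "(c, d) \<notin> s"
    by blast
  have r_sym: "(y, x) \<in> r" if "(x, y) \<in> r" for x y
    using that r by (auto simp: equiv_def dest: symD)
  have r_trans: "(x, z) \<in> r" if "(x, y) \<in> r" "(y, z) \<in> r" for x y z
    using that r by (auto simp: equiv_def dest: transD)
  have s_sym: "(y, x) \<in> s" if "(x, y) \<in> s" for x y
    using that s by (auto simp: equiv_def dest: symD)
  have s_trans: "(x, z) \<in> s" if "(x, y) \<in> s" "(y, z) \<in> s" for x y z
    using that s by (auto simp: equiv_def dest: transD)
  have c_r: "(x, c) \<in> r" if "x \<in> C" for x
  proof (rule ccontr)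
    assume "(x, c) \<notin> r"
    then have "(x, c) \<in> s"
      using cover that cd by blast
    then have "(x, d) \<notin> s"
      using cd(3) s_trans[OF s_sym] by blast
    then have "(x, d) \<in> r" "(c, d) \<in> r"
      using cover that cd by blast+
    then show False
      using \<open>(x, c) \<notin> r\<close> r_trans[OF _ r_sym] by blast
  qed
  then show "\<forall>x\<in>C. \<forall>y\<in>C. (x, y) \<in> r"
    using r_trans[OF _ r_sym] by blast
qed

lemma complete_subset_class:
  assumes "C \<subseteq> A" and "C \<noteq> {}"
    and "\<forall>x\<in>C. \<forall>y\<in>C. (x, y) \<in> r"
  obtains D where "D \<in> A // r" and "C \<subseteq> D"
proof -
  obtain c where "c \<in> C"
    using assms(2) by blast
  then have "r `` {c} \<in> A // r" "C \<subseteq> r `` {c}"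
    using assms(1,3) by (auto intro: quotientI)
  then show thesis
    by (rule that)
qed

text \<open>
  A line \<open>M\<close> of the larger spread contains a point; the line of the smaller spread through that
  point belongs to the larger one too, and so must be \<open>M\<close>.
\<close>
lemma spread_subset_eq:
  assumes "C \<subseteq> D"
    and point: "\<And>M. M \<in> D \<Longrightarrow> \<exists>q\<in>P. incident q M"
    and C: "\<And>q. q \<in> P \<Longrightarrow> \<exists>M\<in>C. incident q M"
    and D: "\<And>q. q \<in> P \<Longrightarrow> \<exists>!M. M \<in> D \<and> incident q M"
  shows "C = D"
proof
  show "D \<subseteq> C"
  proof
    fix M assume "M \<in> D"
    then obtain q where q: "q \<in> P" "incident q M"
      using point by blast
    then obtain M' where "M' \<in> C" "incident q M'"
      using C by blast
    then have "M = M'"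
      using D[OF q(1)] q(2) \<open>M \<in> D\<close> \<open>C \<subseteq> D\<close> by blast
    then show "M \<in> C"
      using \<open>M' \<in> C\<close> by simp
  qed
qed (rule assms(1))

lemma parallelism_class_subset_eq:
  assumes point: "\<And>M. M \<in> L \<Longrightarrow> \<exists>q\<in>P. incident q M"
    and r: "parallelism P L incident r" and s: "parallelism P L incident s"
    and C: "C \<in> L // r" and D: "D \<in> L // s" and sub: "C \<subseteq> D"
  shows "C = D"
proof (rule spread_subset_eq[OF sub])
  have "D \<subseteq> L"
    using s D unfolding parallelism_def by (blast dest: in_quotient_imp_subset)
  then show "\<exists>q\<in>P. incident q M" if "M \<in> D" for M
    using that point by blast
  show "\<exists>M\<in>C. incident q M" if "q \<in> P" for q
    using r C that unfolding parallelism_def by blast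
  show "\<exists>!M. M \<in> D \<and> incident q M" if "q \<in> P" for q
    using s D that unfolding parallelism_def by blast
qed

lemma blend_imp_parallelism:
  assumes "parallelism P L incident r1" and "parallelism P L incident r2"
    and "blend L r1 r2 r3"
  shows "parallelism P L incident r3"
  unfolding parallelism_def
proof (intro conjI ballI)
  show "equiv L r3"
    using assms(3) by (simp add: blend_def)
next
  fix q C assume "q \<in> P" and "C \<in> L // r3"
  then have "C \<in> L // r1 \<or> C \<in> L // r2"
    using assms(3) by (simp add: blend_def)
  then show "\<exists>!M. M \<in> C \<and> incident q M"
    using assms(1,2) \<open>q \<in> P\<close> by (elim disjE) (simp_all add: parallelism_def)
qed

lemma blend_subset_union:
  assumes "equiv L r1" and "equiv L r2" and "blend L r1 r2 r3" and "(M, N) \<in> r3"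
  shows "(M, N) \<in> r1 \<or> (M, N) \<in> r2"
proof -
  have r3: "equiv L r3"
    using assms(3) by (simp add: blend_def)
  let ?C = "r3 `` {M}"
  have M: "M \<in> L"
    using assms(4) equiv_type[OF r3] by blast
  then have "?C \<in> L // r1 \<or> ?C \<in> L // r2"
    using assms(3) by (auto simp: blend_def intro: quotientI)
  moreover have "M \<in> ?C" "N \<in> ?C"
    using M assms(4) equiv_class_self[OF r3] by auto
  ultimately show ?thesis
    using quotient_eq_iff[OF assms(1), of ?C ?C M N] quotient_eq_iff[OF assms(2), of ?C ?C M N]
    by blast
qed

lemma subset_union_imp_blend:
  assumes point: "\<And>M. M \<in> L \<Longrightarrow> \<exists>q\<in>P. incident q M"
    and r1: "parallelism P L incident r1" and r2: "parallelism P L incident r2"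
    and r3: "parallelism P L incident r3"
    and sub: "\<And>M N. (M, N) \<in> r3 \<Longrightarrow> (M, N) \<in> r1 \<or> (M, N) \<in> r2"
  shows "blend L r1 r2 r3"
proof -
  have e1: "equiv L r1" and e2: "equiv L r2" and e3: "equiv L r3"
    using r1 r2 r3 by (simp_all add: parallelism_def)
  have "C \<in> L // r1 \<or> C \<in> L // r2" if C: "C \<in> L // r3" for C
  proof -
    have class_of: "C \<in> L // r"
      if r: "parallelism P L incident r" and all: "\<forall>x\<in>C. \<forall>y\<in>C. (x, y) \<in> r" for r
    proof -
      obtain D where D: "D \<in> L // r" "C \<subseteq> D"
        using in_quotient_imp_subset[OF e3 C] in_quotient_imp_non_empty[OF e3 C] all
        by (rule complete_subset_class)
      have "C = D"
        using point r3 r C D by (rule parallelism_class_subset_eq)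
      then show ?thesis
        using D(1) by simp
    qed
    have "(x, y) \<in> r1 \<or> (x, y) \<in> r2" if "x \<in> C" "y \<in> C" for x y
      using quotient_eq_iff[OF e3 C C that] sub by blast
    then have "(\<forall>x\<in>C. \<forall>y\<in>C. (x, y) \<in> r1) \<or> (\<forall>x\<in>C. \<forall>y\<in>C. (x, y) \<in> r2)"
      by (rule equiv_union_complete[OF e1 e2])
    then show ?thesis
      using class_of[OF r1] class_of[OF r2] by (rule disj_forward)
  qed
  then show ?thesis
    using e3 by (simp add: blend_def)
qed

theorem theorem3p1:
  fixes P :: "'p set" and L :: "'l set" and incident :: "'p \<Rightarrow> 'l \<Rightarrow> bool"
    and par1 par2 :: "('l \<times> 'l) set"
  assumes "projective_space P L incident"
    and "parallelism P L incident par1"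
    and "parallelism P L incident par2"
  shows "(\<forall>par3. blend L par1 par2 par3 \<longrightarrow> parallelism P L incident par3) \<and>
         (\<forall>par3. parallelism P L incident par3 \<longrightarrow>
            (blend L par1 par2 par3 \<longleftrightarrow>
             (\<forall>M\<in>L. \<forall>N\<in>L. (M, N) \<in> par3 \<longrightarrow> (M, N) \<in> par1 \<or> (M, N) \<in> par2)))"
proof (intro conjI allI impI iffI ballI)
  fix par3 assume "blend L par1 par2 par3"
  with assms(2,3) show "parallelism P L incident par3"
    by (rule blend_imp_parallelism)
next
  fix par3 M N
  have "equiv L par1" "equiv L par2"
    using assms(2,3) by (simp_all add: parallelism_def)
  moreover assume "blend L par1 par2 par3" "(M, N) \<in> par3"
  ultimately show "(M, N) \<in> par1 \<or> (M, N) \<in> par2"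
    by (rule blend_subset_union)
next
  fix par3
  assume par3: "parallelism P L incident par3"
    and sub: "\<forall>M\<in>L. \<forall>N\<in>L. (M, N) \<in> par3 \<longrightarrow> (M, N) \<in> par1 \<or> (M, N) \<in> par2"
  have point: "\<exists>q\<in>P. incident q M" if "M \<in> L" for M
    using projective_space.three_points[OF assms(1) that] by blast
  have "par3 \<subseteq> L \<times> L"
    using par3 by (simp add: parallelism_def equiv_type)
  then have "(M, N) \<in> par1 \<or> (M, N) \<in> par2" if "(M, N) \<in> par3" for M N
    using sub that by blast
  with point assms(2,3) par3 show "blend L par1 par2 par3"
    by (rule subset_union_imp_blend)
qed

end
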